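(* Let $\mathcal{A}\in\mathbb{R}^{I_1\times\cdots\times I_d}$ and let the TT-ULV algorithm (left-to-right sweep) be run on $\mathcal{A}$ with admissible ranks $r_1,\dots,r_{d-1}$, $r_0=r_d=1$. If, for $k=1,\dots,d-1$, the error of the $k$th truncated ULV decomposition computed by the algorithm is $\varepsilon_k$ (that is, $\|\mathbf{E}\|_F=\varepsilon_k$ for the residual $\mathbf{E}$ in step (ii) of iteration $k$), then the computed TT-approximation $\widehat{\mathcal{A}}$ satisfies $$\|\mathcal{A}-\widehat{\mathcal{A}}\|_F\le\sqrt{\sum_{k=1}^{d-1}\varepsilon_k^2}.$$
   Context: Let $d\ge 2$. $\|\cdot\|_F$ is the Frobenius norm (square root of the sum of squares of all entries) of a matrix or tensor. All reshapings use the reverse lexicographic (column-major, MATLAB `reshape`) ordering: a multi-index $(i_1,\dots,i_p)$ with dimensions $(J_1,\dots,J_p)$ is merged into $i_1+\sum_{k=2}^p(i_k-1)\prod_{j<k}J_j$. TT format: a tensor is in TT format with cores $\mathcal{G}^{(k)}\in\mathbb{R}^{r_{k-1}\times I_k\times r_k}$ ($r_0=r_d=1$) if its entries are $\sum_{\alpha_0,\dots,\alpha_d}\mathcal{G}^{(1)}_{\alpha_0i_1\alpha_1}\cdots\mathcal{G}^{(d)}_{\alpha_{d-1}i_d\alpha_d}$, where $1\le\alpha_k\le r_k$. ULV decomposition of $\mathbf{A}\in\mathbb{R}^{m\times n}$ with leading block size $r\le\min(m,n)$: $\mathbf{A}=\mathbf{U}\begin{bmatrix}\mathbf{L}_{11}&\mathbf{O}\\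 \mathbf{L}_{21}&\mathbf{L}_{22}\end{bmatrix}\mathbf{V}^\top$, where $\mathbf{U}=[\mathbf{U}_1\ \mathbf{U}_2]\in\mathbb{R}^{m\times m}$ and $\mathbf{V}=[\mathbf{V}_1\ \mathbf{V}_2]\in\mathbb{R}^{n\times n}$ are orthogonal, $\mathbf{U}_1,\mathbf{V}_1$ have $r$ columns, $\mathbf{L}_{11}\in\mathbb{R}^{r\times r}$ and $\mathbf{L}_{22}\in\mathbb{R}^{(m-r)\times(n-r)}$ are lower triangular (entries $(i,j)$ with $j>i$ vanish), and $\mathbf{L}_{21}\in\mathbb{R}^{(m-r)\times r}$. Its rank-$r$ truncation is $\mathbf{U}_1\mathbf{L}_{11}\mathbf{V}_1^\top$, with residual $\mathbf{E}=\mathbf{A}-\mathbf{U}_1\mathbf{L}_{11}\mathbf{V}_1^\top=\mathbf{U}_2(\mathbf{L}_{21}\mathbf{V}_1^\top+\mathbf{L}_{22}\mathbf{V}_2^\top)$. TT-ULV algorithm (left-to-right sweep, ranks $r_1,\dots,r_{d-1}$, $r_0=r_d=1$). Start with $\mathbf{C}=\mathrm{reshape}(\mathcal{A},[I_1,\,I_2\cdots I_d])$. For $k=1,\dots,d-1$: (i) set $\mathbf{C}:=\mathrm{reshape}(\mathbf{C},[r_{k-1}I_k,\,I_{k+1}\cdots I_d])$; (ii) compute a ULV decomposition of $\mathbf{C}$ with leading block size $r_k$, $\mathbf{C}=\mathbf{U}_1\mathbf{L}_{11}\mathbf{V}_1^\top+\mathbf{E}$; (iii) set $\mathcal{G}^{(k)}=\mathrm{reshape}(\mathbf{U}_1,[r_{k-1},I_k,r_k])$;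 (iv) set $\mathbf{C}:=\mathbf{L}_{11}\mathbf{V}_1^\top$. Finally $\mathcal{G}^{(d)}=\mathbf{C}$ (viewed as $r_{d-1}\times I_d\times 1$). The output $\widehat{\mathcal{A}}$ is the tensor in TT format with cores $\mathcal{G}^{(1)},\dots,\mathcal{G}^{(d)}$. The ranks are admissible if $1\le r_k\le\min(r_{k-1}I_k,\,I_{k+1}\cdots I_d)$ for $k=1,\dots,d-1$, so that every step makes sense. *)

theory Defs
  imports Complex_Main "Jordan_Normal_Form.Matrix"
begin

text \<open>A tensor is a function on multi-indices; its dimensions \<open>J\<close> are passed alongside, and values
  outside \<open>multi_indices J\<close> are irrelevant. Entry indices start at 0, as in the matrix library.\<close>

type_synonym tensor = "nat list \<Rightarrow> real"

definition multi_indices :: "nat list \<Rightarrow> nat list set" where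
  "multi_indices J = {i. length i = length J \<and> (\<forall>k<length J. i ! k < J ! k)}"

text \<open>With 0-based entries the column-major position of \<open>(i\<^sub>1, \<dots>, i\<^sub>p)\<close> is
  \<open>\<Sum>\<^sub>k i\<^sub>k \<Prod>\<^sub>j\<^sub><\<^sub>k J\<^sub>j\<close>.\<close>

definition lin_index :: "nat list \<Rightarrow> nat list \<Rightarrow> nat" where
  "lin_index J i = (\<Sum>k<length J. i ! k * (\<Prod>j<k. J ! j))"

text \<open>\<open>reshape J J' T\<close> takes \<open>T\<close> of dimensions \<open>J\<close> to dimensions \<open>J'\<close>; it is meant for
  \<open>prod_list J = prod_list J'\<close>, and is well-defined by \<open>lin_index_bij\<close> below.\<close>

definition reshape :: "nat list \<Rightarrow> nat list \<Rightarrow> tensor \<Rightarrow> tensor" where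
  "reshape J J' T = (\<lambda>i'. T (inv_into (multi_indices J) (lin_index J) (lin_index J' i')))"

definition tensor_of_mat :: "real mat \<Rightarrow> tensor" where
  "tensor_of_mat A = (\<lambda>i. A $$ (i ! 0, i ! 1))"

definition mat_of_tensor :: "nat \<Rightarrow> nat \<Rightarrow> tensor \<Rightarrow> real mat" where
  "mat_of_tensor m n T = mat m n (\<lambda>(i, j). T [i, j])"

definition tensor_norm :: "nat list \<Rightarrow> tensor \<Rightarrow> real" where
  "tensor_norm J T = sqrt (\<Sum>i\<in>multi_indices J. (T i)\<^sup>2)"

definition mat_norm :: "real mat \<Rightarrow> real" where
  "mat_norm A = sqrt (\<Sum>i<dim_row A. \<Sum>j<dim_col A. (A $$ (i, j))\<^sup>2)"

text \<open>The modes are numbered \<open>1, \<dots>, d\<close> (with sizes \<open>I 1, \<dots>, I d\<close>) and the ranks are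
  \<open>r 0, \<dots>, r d\<close>.\<close>

definition dims :: "nat \<Rightarrow> (nat \<Rightarrow> nat) \<Rightarrow> nat list" where
  "dims d I = map I [1..<Suc d]"

text \<open>Mode \<open>k\<close> of the multi-index sits at list position \<open>k - 1\<close>, whereas \<open>\<alpha>\<close> starts with
  \<open>\<alpha>\<^sub>0\<close>.\<close>

definition tt_tensor :: "nat \<Rightarrow> (nat \<Rightarrow> nat) \<Rightarrow> (nat \<Rightarrow> tensor) \<Rightarrow> tensor" where
  "tt_tensor d r G = (\<lambda>i. \<Sum>\<alpha>\<in>multi_indices (map r [0..<Suc d]).
     \<Prod>k=1..d. G k [\<alpha> ! (k - 1), i ! (k - 1), \<alpha> ! k])"

text \<open>The library's \<open>orthogonal_mat\<close> does not require the columns to have norm 1.\<close>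

definition orthonormal_mat :: "nat \<Rightarrow> real mat \<Rightarrow> bool" where
  "orthonormal_mat n U \<longleftrightarrow> U \<in> carrier_mat n n \<and>
     transpose_mat U * U = 1\<^sub>m n \<and> U * transpose_mat U = 1\<^sub>m n"

definition lower_triangular :: "real mat \<Rightarrow> bool" where
  "lower_triangular L \<longleftrightarrow> (\<forall>i<dim_row L. \<forall>j<dim_col L. i < j \<longrightarrow> L $$ (i, j) = 0)"

definition leading_cols :: "nat \<Rightarrow> real mat \<Rightarrow> real mat" where
  "leading_cols r U = mat (dim_row U) r (\<lambda>(i, j). U $$ (i, j))"

record ulv =
  ulv_U :: "real mat"
  ulv_L11 :: "real mat"
  ulv_L21 :: "real mat"
  ulv_L22 :: "real mat"
  ulv_V :: "real mat"

definition is_ulv :: "real mat \<Rightarrow> nat \<Rightarrow> ulv \<Rightarrow> bool" where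
  "is_ulv A r D \<longleftrightarrow>
     (let m = dim_row A; n = dim_col A in
        r \<le> min m n \<and>
        orthonormal_mat m (ulv_U D) \<and> orthonormal_mat n (ulv_V D) \<and>
        ulv_L11 D \<in> carrier_mat r r \<and> lower_triangular (ulv_L11 D) \<and>
        ulv_L21 D \<in> carrier_mat (m - r) r \<and>
        ulv_L22 D \<in> carrier_mat (m - r) (n - r) \<and> lower_triangular (ulv_L22 D) \<and>
        A = ulv_U D *
            four_block_mat (ulv_L11 D) (0\<^sub>m r (n - r)) (ulv_L21 D) (ulv_L22 D) *
            transpose_mat (ulv_V D))"

definition ulv_U1 :: "nat \<Rightarrow> ulv \<Rightarrow> real mat" where
  "ulv_U1 r D = leading_cols r (ulv_U D)"

definition ulv_V1 :: "nat \<Rightarrow> ulv \<Rightarrow> real mat" where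
  "ulv_V1 r D = leading_cols r (ulv_V D)"

definition ulv_residual :: "real mat \<Rightarrow> nat \<Rightarrow> ulv \<Rightarrow> real mat" where
  "ulv_residual A r D = A - ulv_U1 r D * ulv_L11 D * transpose_mat (ulv_V1 r D)"

text \<open>ULV decompositions are not unique, so a run of the algorithm is determined by the sequence
  \<open>D 1, \<dots>, D (d - 1)\<close> of decompositions chosen. \<open>tt_ulv_C\<close> is \<open>C\<close> after iteration \<open>k\<close>, and
  \<open>tt_ulv_mat\<close> is the reshaped \<open>C\<close> that is decomposed in iteration \<open>k\<close>.\<close>

fun tt_ulv_C :: "nat \<Rightarrow> (nat \<Rightarrow> nat) \<Rightarrow> (nat \<Rightarrow> nat) \<Rightarrow> tensor \<Rightarrow> (nat \<Rightarrow> ulv) \<Rightarrow> nat \<Rightarrow> real mat" where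
  "tt_ulv_C d I r A D 0 =
     mat_of_tensor (I 1) (\<Prod>j=2..d. I j)
       (reshape (dims d I) [I 1, \<Prod>j=2..d. I j] A)"
| "tt_ulv_C d I r A D (Suc k) =
     ulv_L11 (D (Suc k)) * transpose_mat (ulv_V1 (r (Suc k)) (D (Suc k)))"

definition tt_ulv_mat ::
  "nat \<Rightarrow> (nat \<Rightarrow> nat) \<Rightarrow> (nat \<Rightarrow> nat) \<Rightarrow> tensor \<Rightarrow> (nat \<Rightarrow> ulv) \<Rightarrow> nat \<Rightarrow> real mat" where
  "tt_ulv_mat d I r A D k =
     (let C = tt_ulv_C d I r A D (k - 1); m = r (k - 1) * I k; n = (\<Prod>j=k+1..d. I j) in
        mat_of_tensor m n (reshape [dim_row C, dim_col C] [m, n] (tensor_of_mat C)))"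

definition tt_ulv_run ::
  "nat \<Rightarrow> (nat \<Rightarrow> nat) \<Rightarrow> (nat \<Rightarrow> nat) \<Rightarrow> tensor \<Rightarrow> (nat \<Rightarrow> ulv) \<Rightarrow> bool" where
  "tt_ulv_run d I r A D \<longleftrightarrow> (\<forall>k\<in>{1..d-1}. is_ulv (tt_ulv_mat d I r A D k) (r k) (D k))"

definition tt_ulv_core ::
  "nat \<Rightarrow> (nat \<Rightarrow> nat) \<Rightarrow> (nat \<Rightarrow> nat) \<Rightarrow> tensor \<Rightarrow> (nat \<Rightarrow> ulv) \<Rightarrow> nat \<Rightarrow> tensor" where
  "tt_ulv_core d I r A D k =
     (if k < d
      then reshape [r (k - 1) * I k, r k] [r (k - 1), I k, r k]
             (tensor_of_mat (ulv_U1 (r k) (D k)))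
      else reshape [r (d - 1), I d] [r (d - 1), I d, 1]
             (tensor_of_mat (tt_ulv_C d I r A D (d - 1))))"

definition tt_ulv_output ::
  "nat \<Rightarrow> (nat \<Rightarrow> nat) \<Rightarrow> (nat \<Rightarrow> nat) \<Rightarrow> tensor \<Rightarrow> (nat \<Rightarrow> ulv) \<Rightarrow> tensor" where
  "tt_ulv_output d I r A D = tt_tensor d r (tt_ulv_core d I r A D)"

definition tt_ulv_error ::
  "nat \<Rightarrow> (nat \<Rightarrow> nat) \<Rightarrow> (nat \<Rightarrow> nat) \<Rightarrow> tensor \<Rightarrow> (nat \<Rightarrow> ulv) \<Rightarrow> nat \<Rightarrow> real" where
  "tt_ulv_error d I r A D k = mat_norm (ulv_residual (tt_ulv_mat d I r A D k) (r k) (D k))"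

definition admissible_ranks :: "nat \<Rightarrow> (nat \<Rightarrow> nat) \<Rightarrow> (nat \<Rightarrow> nat) \<Rightarrow> bool" where
  "admissible_ranks d I r \<longleftrightarrow> r 0 = 1 \<and> r d = 1 \<and>
     (\<forall>k\<in>{1..d-1}. 1 \<le> r k \<and> r k \<le> min (r (k - 1) * I k) (\<Prod>j=k+1..d. I j))"

lemma multi_indices_Cons:
  "multi_indices (n # J) = (\<lambda>(a, i). a # i) ` ({..<n} \<times> multi_indices J)"
proof (rule Set.set_eqI)
  fix x
  show "x \<in> multi_indices (n # J) \<longleftrightarrow> x \<in> (\<lambda>(a, i). a # i) ` ({..<n} \<times> multi_indices J)"
    by (cases x) (auto simp: multi_indices_def image_iff less_Suc_eq_0_disj All_less_Suc2)
qed

lemma lin_index_Cons: "lin_index (n # J) (a # i) = a + n * lin_index J i"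
  unfolding lin_index_def
  by (simp add: sum.lessThan_Suc_shift prod.lessThan_Suc_shift sum_distrib_left
      mult.left_commute del: sum.lessThan_Suc prod.lessThan_Suc)

lemma lin_index_bij: "bij_betw (lin_index J) (multi_indices J) {..<prod_list J}"
proof (induction J)
  case Nil
  then show ?case by (auto simp: bij_betw_def multi_indices_def lin_index_def)
next
  case (Cons n J)
  have inj: "inj_on (lin_index (n # J)) (multi_indices (n # J))"
  proof (rule inj_onI)
    fix x y assume x: "x \<in> multi_indices (n # J)" and y: "y \<in> multi_indices (n # J)"
      and eq: "lin_index (n # J) x = lin_index (n # J) y"
    from x obtain a i where xa: "x = a # i" "a < n" "i \<in> multi_indices J"
      by (auto simp: multi_indices_Cons)
    from y obtain b j where yb: "y = b # j" "b < n" "j \<in> multi_indices J"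
      by (auto simp: multi_indices_Cons)
    have e: "a + n * lin_index J i = b + n * lin_index J j"
      using eq xa yb by (simp add: lin_index_Cons)
    have "a = b" using arg_cong[OF e, of "\<lambda>t. t mod n"] xa yb by simp
    moreover have "lin_index J i = lin_index J j" using e \<open>a = b\<close> xa by simp
    ultimately show "x = y" using Cons xa yb by (auto simp: bij_betw_def dest: inj_onD)
  qed
  have "t \<in> lin_index (n # J) ` multi_indices (n # J)" if t: "t < n * prod_list J" for t
  proof -
    have n: "n > 0" using t by (cases n) auto
    have "t div n < prod_list J" using t by (simp add: less_mult_imp_div_less mult.commute)
    then have "t div n \<in> lin_index J ` multi_indices J"
      using bij_betw_imp_surj_on[OF Cons] by simp
    then obtain i where i: "i \<in> multi_indices J" "lin_index J i = t div n"
      by auto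
    have "lin_index (n # J) (t mod n # i) = t" using i by (simp add: lin_index_Cons)
    moreover have "t mod n # i \<in> multi_indices (n # J)"
      using i n by (auto simp: multi_indices_Cons)
    ultimately show ?thesis by (metis imageI)
  qed
  moreover have "lin_index (n # J) x < n * prod_list J" if "x \<in> multi_indices (n # J)" for x
  proof -
    from that obtain a i where xa: "x = a # i" "a < n" "i \<in> multi_indices J"
      by (auto simp: multi_indices_Cons)
    have "lin_index J i < prod_list J" using Cons xa by (auto simp: bij_betw_def)
    then have "n * Suc (lin_index J i) \<le> n * prod_list J" by (intro mult_le_mono2) simp
    then show ?thesis using xa by (simp add: lin_index_Cons)
  qed
  ultimately show ?case using inj by (auto simp: bij_betw_def)
qed

end

theory Submission
  imports Defs
begin

text \<open>The error is telescoped mode by mode, and the bound is in fact an equality. Write \<open>C\<^sub>k\<close> for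
  the remainder \<open>L\<^sub>1\<^sub>1 V\<^sub>1\<^sup>T\<close> after iteration \<open>k\<close>, whose columns are indexed by the modes
  \<open>k+1, \<dots>, d\<close>, and \<open>T\<^sub>k\<close> for the array of the same shape obtained by contracting the cores
  \<open>k+1, \<dots>, d\<close>. Up to reshaping, which only renames entries, iteration \<open>k\<close> gives
  \<open>C\<^sub>k\<^sub>-\<^sub>1 = U\<^sub>1 C\<^sub>k + E\<close>, while \<open>T\<^sub>k\<^sub>-\<^sub>1 = U\<^sub>1 T\<^sub>k\<close> by the choice of the \<open>k\<close>th core. Hence
  \<open>C\<^sub>k\<^sub>-\<^sub>1 - T\<^sub>k\<^sub>-\<^sub>1 = E + U\<^sub>1 (C\<^sub>k - T\<^sub>k)\<close>.

  Since \<open>U\<close> is orthogonal and the upper right block of the middle factor vanishes,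
  \<open>U\<^sub>1\<^sup>T C\<^sub>k\<^sub>-\<^sub>1 = L\<^sub>1\<^sub>1 V\<^sub>1\<^sup>T = C\<^sub>k\<close>, so that \<open>U\<^sub>1\<^sup>T E = 0\<close>. The two summands are therefore orthogonal
  and \<open>U\<^sub>1\<close> preserves norms (\<open>ulv_pythagoras\<close>), so the squared error at stage \<open>k - 1\<close> is
  \<open>\<epsilon>\<^sub>k\<^sup>2\<close> plus the one at stage \<open>k\<close> (\<open>tail_error_step\<close>). The last core is \<open>C\<^sub>d\<^sub>-\<^sub>1\<close> itself, which
  leaves no error at stage \<open>d - 1\<close>; at stage 0 the error is that of the whole tensor.\<close>

section \<open>Reshaping and sums over multi-indices\<close>

lemma reshape_eq:
  assumes "i \<in> multi_indices J" "lin_index J i = lin_index J' i'"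
  shows "reshape J J' T i' = T i"
  using assms lin_index_bij[of J]
  by (metis bij_betw_def inv_into_f_f reshape_def)

lemma multi_indices_Nil [simp]: "multi_indices [] = {[]}"
  by (auto simp: multi_indices_def)

lemma Cons_in_multi_indices [simp]:
  "a # i \<in> multi_indices (n # J) \<longleftrightarrow> a < n \<and> i \<in> multi_indices J"
  by (auto simp: multi_indices_Cons)

lemma lin_index_Nil [simp]: "lin_index [] i = 0"
  by (simp add: lin_index_def)

lemma sum_multi_indices_Cons:
  "(\<Sum>x\<in>multi_indices (n # J). f x) = (\<Sum>a<n. \<Sum>i\<in>multi_indices J. f (a # i))"
proof -
  have "inj_on (\<lambda>(a, i). a # i) ({..<n} \<times> multi_indices J)"
    by (auto simp: inj_on_def)
  then show ?thesis
    unfolding multi_indices_Cons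
    by (subst sum.reindex) (auto simp: sum.cartesian_product case_prod_beta)
qed

lemma sum_column_major:
  fixes f :: "nat \<Rightarrow> 'a::comm_monoid_add"
  shows "(\<Sum>i<n. \<Sum>a<m. f (a + m * i)) = (\<Sum>p<m * n. f p)"
proof -
  have "(\<Sum>a<m. f (a + m * i)) = sum f {i * m..<i * m + m}" for i
    using sum.shift_bounds_nat_ivl[of f 0 "m * i" m]
    by (simp add: atLeast0LessThan mult.commute add.commute)
  then show ?thesis
    by (simp add: sum.nat_group mult.commute)
qed

lemma prod_list_map_upt: "prod_list (map f [a..<Suc b]) = (\<Prod>j=a..b. f j)"
  for f :: "nat \<Rightarrow> nat"
  by (simp add: prod.distinct_set_conv_list[symmetric] atLeastLessThanSuc_atLeastAtMost
      del: upt_Suc)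

section \<open>One truncated ULV decomposition\<close>

lemma orthonormal_pythagoras:
  fixes u :: "'a \<Rightarrow> 'b \<Rightarrow> real"
  assumes "finite B"
    and ortho: "\<And>b c. b \<in> B \<Longrightarrow> c \<in> B \<Longrightarrow> (\<Sum>p\<in>P. u p b * u p c) = (if b = c then 1 else 0)"
    and perp: "\<And>b. b \<in> B \<Longrightarrow> (\<Sum>p\<in>P. u p b * e p) = 0"
  shows "(\<Sum>p\<in>P. (e p + (\<Sum>b\<in>B. u p b * y b))\<^sup>2) = (\<Sum>p\<in>P. (e p)\<^sup>2) + (\<Sum>b\<in>B. (y b)\<^sup>2)"
proof -
  have "(\<Sum>p\<in>P. e p * (\<Sum>b\<in>B. u p b * y b)) = (\<Sum>b\<in>B. y b * (\<Sum>p\<in>P. u p b * e p))"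
    by (simp add: sum_distrib_left mult_ac sum.swap[of _ B P])
  then have cross: "(\<Sum>p\<in>P. e p * (\<Sum>b\<in>B. u p b * y b)) = 0"
    using perp by simp
  have "(\<Sum>p\<in>P. (\<Sum>b\<in>B. u p b * y b)\<^sup>2)
      = (\<Sum>p\<in>P. \<Sum>b\<in>B. \<Sum>c\<in>B. y b * y c * (u p b * u p c))"
    by (simp add: power2_eq_square sum_product mult_ac)
  also have "\<dots> = (\<Sum>b\<in>B. \<Sum>c\<in>B. y b * y c * (\<Sum>p\<in>P. u p b * u p c))"
    by (simp add: sum_distrib_left sum.swap[of _ B P])
  also have "\<dots> = (\<Sum>b\<in>B. \<Sum>c\<in>B. if b = c then y b * y c else 0)"
    by (intro sum.cong refl) (simp add: ortho)
  also have "\<dots> = (\<Sum>b\<in>B. (y b)\<^sup>2)"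
    using \<open>finite B\<close> by (simp add: power2_eq_square)
  finally show ?thesis
    using cross
    by (simp add: power2_sum sum.distrib mult.assoc flip: sum_distrib_left)
qed

lemma ulv_dims:
  assumes "is_ulv M r D"
  shows "ulv_U D \<in> carrier_mat (dim_row M) (dim_row M)"
    and "ulv_V D \<in> carrier_mat (dim_col M) (dim_col M)"
    and "ulv_L11 D \<in> carrier_mat r r"
    and "ulv_L21 D \<in> carrier_mat (dim_row M - r) r"
    and "ulv_L22 D \<in> carrier_mat (dim_row M - r) (dim_col M - r)"
    and "r \<le> dim_row M" and "r \<le> dim_col M"
  using assms by (auto simp: is_ulv_def Let_def orthonormal_mat_def)

lemma ulv_U1_orthonormal:
  assumes ulv: "is_ulv M r D" and "b < r" "c < r"
  shows "(\<Sum>p<dim_row M. ulv_U1 r D $$ (p, b) * ulv_U1 r D $$ (p, c)) = (if b = c then 1 else 0)"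
proof -
  note dims = ulv_dims[OF ulv]
  have "transpose_mat (ulv_U D) * ulv_U D = 1\<^sub>m (dim_row M)"
    using ulv by (simp add: is_ulv_def Let_def orthonormal_mat_def)
  then have "(transpose_mat (ulv_U D) * ulv_U D) $$ (b, c) = (1\<^sub>m (dim_row M) :: real mat) $$ (b, c)"
    by simp
  then show ?thesis
    using dims assms
    by (simp add: scalar_prod_def ulv_U1_def leading_cols_def atLeast0LessThan)
qed

text \<open>Multiplying the decomposition by \<open>U\<^sup>T\<close> from the left leaves the middle factor times
  \<open>V\<^sup>T\<close>; its first \<open>r\<close> rows see only \<open>L\<^sub>1\<^sub>1\<close>, because the block to the right of it is zero.\<close>

lemma ulv_U1_times_mat:
  assumes ulv: "is_ulv M r D" and "b < r" "t < dim_col M"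
  shows "(\<Sum>p<dim_row M. ulv_U1 r D $$ (p, b) * M $$ (p, t))
    = (ulv_L11 D * transpose_mat (ulv_V1 r D)) $$ (b, t)"
proof -
  let ?m = "dim_row M" and ?n = "dim_col M"
  define S where
    "S = four_block_mat (ulv_L11 D) (0\<^sub>m r (?n - r)) (ulv_L21 D) (ulv_L22 D)"
  note dims = ulv_dims[OF ulv]
  have S: "S \<in> carrier_mat ?m ?n"
    using dims unfolding S_def carrier_mat_def by auto
  have UU: "transpose_mat (ulv_U D) * ulv_U D = 1\<^sub>m ?m"
    using ulv by (simp add: is_ulv_def Let_def orthonormal_mat_def)
  have M: "M = ulv_U D * S * transpose_mat (ulv_V D)"
    using ulv by (simp add: is_ulv_def Let_def S_def)
  have "transpose_mat (ulv_U D) * M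
      = transpose_mat (ulv_U D) * (ulv_U D * (S * transpose_mat (ulv_V D)))"
    using dims S by (subst M) (simp add: assoc_mult_mat[of _ ?m ?m _ ?n _ ?n])
  also have "\<dots> = (transpose_mat (ulv_U D) * ulv_U D) * (S * transpose_mat (ulv_V D))"
    using dims S by (intro assoc_mult_mat[symmetric, of _ ?m ?m _ ?m _ ?n]) auto
  also have "\<dots> = S * transpose_mat (ulv_V D)"
    using dims S by (simp add: UU)
  finally have UM: "(transpose_mat (ulv_U D) * M) $$ (b, t) = (S * transpose_mat (ulv_V D)) $$ (b, t)"
    by simp
  have "(S * transpose_mat (ulv_V D)) $$ (b, t) = (\<Sum>c<?n. S $$ (b, c) * ulv_V D $$ (t, c))"
    using dims S assms by (simp add: scalar_prod_def atLeast0LessThan)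
  also have "\<dots> = (\<Sum>c<r. S $$ (b, c) * ulv_V D $$ (t, c))"
    using dims assms
    by (intro sum.mono_neutral_right) (auto simp: S_def)
  also have "\<dots> = (\<Sum>c<r. ulv_L11 D $$ (b, c) * ulv_V D $$ (t, c))"
    using dims assms by (intro sum.cong) (auto simp: S_def)
  also have "\<dots> = (ulv_L11 D * transpose_mat (ulv_V1 r D)) $$ (b, t)"
    using dims assms
    by (simp add: scalar_prod_def ulv_V1_def leading_cols_def atLeast0LessThan)
  finally show ?thesis
    using UM dims assms
    by (simp add: scalar_prod_def ulv_U1_def leading_cols_def atLeast0LessThan)
qed

text \<open>Replacing the remainder \<open>L\<^sub>1\<^sub>1 V\<^sub>1\<^sup>T\<close> by any other matrix \<open>X\<close> adds the squared distance of
  the two to the squared truncation error: the residual has columns orthogonal to those of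
  \<open>U\<^sub>1\<close>, in which the replacement takes place.\<close>

lemma ulv_pythagoras:
  assumes ulv: "is_ulv M r D"
  defines "C \<equiv> ulv_L11 D * transpose_mat (ulv_V1 r D)"
  shows "(\<Sum>t<dim_col M. \<Sum>p<dim_row M. (M $$ (p, t) - (\<Sum>b<r. ulv_U1 r D $$ (p, b) * X b t))\<^sup>2)
    = (mat_norm (ulv_residual M r D))\<^sup>2 + (\<Sum>t<dim_col M. \<Sum>b<r. (C $$ (b, t) - X b t)\<^sup>2)"
proof -
  let ?m = "dim_row M" and ?n = "dim_col M" and ?U = "ulv_U1 r D"
  let ?E = "ulv_residual M r D"
  note dims = ulv_dims[OF ulv]
  have C: "C \<in> carrier_mat r ?n" and U: "?U \<in> carrier_mat ?m r"
    and V: "ulv_V1 r D \<in> carrier_mat ?n r"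
    using dims by (auto simp: C_def ulv_V1_def ulv_U1_def leading_cols_def)
  have resid: "?E = M - ?U * C"
    unfolding ulv_residual_def C_def using dims U V by (simp add: assoc_mult_mat[of _ ?m r _ r _ ?n])
  have E: "?E $$ (p, t) = M $$ (p, t) - (\<Sum>b<r. ?U $$ (p, b) * C $$ (b, t))"
    if "p < ?m" "t < ?n" for p t
    using that U C by (simp add: resid scalar_prod_def atLeast0LessThan)
  have column: "(\<Sum>p<?m. (M $$ (p, t) - (\<Sum>b<r. ?U $$ (p, b) * X b t))\<^sup>2)
      = (\<Sum>p<?m. (?E $$ (p, t))\<^sup>2) + (\<Sum>b<r. (C $$ (b, t) - X b t)\<^sup>2)"
    if t: "t < ?n" for t
  proof -
    have perp: "(\<Sum>p<?m. ?U $$ (p, b) * ?E $$ (p, t)) = 0" if b: "b < r" for b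
    proof -
      have "(\<Sum>p<?m. ?U $$ (p, b) * ?E $$ (p, t))
          = (\<Sum>p<?m. ?U $$ (p, b) * M $$ (p, t))
            - (\<Sum>p<?m. \<Sum>c<r. ?U $$ (p, b) * (?U $$ (p, c) * C $$ (c, t)))"
        by (simp add: E t right_diff_distrib sum_subtractf sum_distrib_left)
      also have "(\<Sum>p<?m. \<Sum>c<r. ?U $$ (p, b) * (?U $$ (p, c) * C $$ (c, t)))
          = (\<Sum>c<r. (\<Sum>p<?m. ?U $$ (p, b) * ?U $$ (p, c)) * C $$ (c, t))"
        by (subst sum.swap) (simp add: sum_distrib_right mult.assoc)
      also have "\<dots> = (\<Sum>c<r. if b = c then C $$ (c, t) else 0)"
        by (intro sum.cong refl) (simp add: ulv_U1_orthonormal[OF ulv b])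
      also have "\<dots> = C $$ (b, t)"
        using b by simp
      finally show ?thesis
        using ulv_U1_times_mat[OF ulv b t] by (simp add: C_def)
    qed
    have "(\<Sum>p<?m. (M $$ (p, t) - (\<Sum>b<r. ?U $$ (p, b) * X b t))\<^sup>2)
        = (\<Sum>p<?m. (?E $$ (p, t) + (\<Sum>b<r. ?U $$ (p, b) * (C $$ (b, t) - X b t)))\<^sup>2)"
      by (intro sum.cong refl) (simp add: E t right_diff_distrib sum_subtractf)
    also have "\<dots> = (\<Sum>p<?m. (?E $$ (p, t))\<^sup>2) + (\<Sum>b<r. (C $$ (b, t) - X b t)\<^sup>2)"
      using ulv_U1_orthonormal[OF ulv] perp by (intro orthonormal_pythagoras) auto
    finally show ?thesis .
  qed
  have "(mat_norm ?E)\<^sup>2 = (\<Sum>p<?m. \<Sum>t<?n. (?E $$ (p, t))\<^sup>2)"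
    using U C by (simp add: mat_norm_def resid sum_nonneg)
  also have "\<dots> = (\<Sum>t<?n. \<Sum>p<?m. (?E $$ (p, t))\<^sup>2)"
    by (rule sum.swap)
  finally show ?thesis
    by (simp add: column sum.distrib)
qed

section \<open>Contracting the trailing cores\<close>

fun tt_tail :: "(nat \<Rightarrow> nat) \<Rightarrow> (nat \<Rightarrow> tensor) \<Rightarrow> nat \<Rightarrow> nat list \<Rightarrow> nat \<Rightarrow> real" where
  "tt_tail r G k [] a = 1"
| "tt_tail r G k (i # x) a = (\<Sum>b<r k. G k [a, i, b] * tt_tail r G (Suc k) x b)"

text \<open>The weight \<open>h\<close> on the leading rank index is what makes the induction go through: peeling
  off the first core turns that core into the weight for the remaining ones.\<close>

lemma sum_weighted_cores_eq_tail:
  "(\<Sum>\<alpha>\<in>multi_indices (map r [k..<Suc (k + length x)]).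
      h (\<alpha> ! 0) * (\<Prod>j<length x. G (Suc (k + j)) [\<alpha> ! j, x ! j, \<alpha> ! Suc j]))
   = (\<Sum>a<r k. h a * tt_tail r G (Suc k) x a)"
proof (induction x arbitrary: k h)
  case Nil
  then show ?case by (simp add: sum_multi_indices_Cons)
next
  case (Cons i x)
  have ranks: "map r [k..<Suc (k + length (i # x))]
      = r k # map r [Suc k..<Suc (Suc k + length x)]"
    by (subst upt_conv_Cons) (auto simp del: upt_Suc)
  show ?case
    unfolding ranks sum_multi_indices_Cons
    using Cons.IH[where k = "Suc k" and h = "\<lambda>b. G (Suc k) [_, i, b]"]
    by (simp add: mult.assoc prod.lessThan_Suc_shift flip: sum_distrib_left
        del: upt_Suc prod.lessThan_Suc)
qed

lemma tt_tensor_eq_tail: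
  assumes "r 0 = 1" and "length x = d"
  shows "tt_tensor d r G x = tt_tail r G 1 x 0"
proof -
  have "(\<Prod>k=1..d. G k [\<alpha> ! (k - 1), x ! (k - 1), \<alpha> ! k])
      = (\<Prod>j<d. G (Suc j) [\<alpha> ! j, x ! j, \<alpha> ! Suc j])" for \<alpha>
    by (rule prod.reindex_bij_witness[of _ Suc "\<lambda>k. k - 1"]) auto
  then show ?thesis
    using sum_weighted_cores_eq_tail[where r = r and k = 0 and x = x and h = "\<lambda>_. 1" and G = G] assms
    by (simp add: tt_tensor_def del: upt_Suc)
qed

section \<open>The sweep, entry by entry\<close>

abbreviation tail_dims :: "nat \<Rightarrow> (nat \<Rightarrow> nat) \<Rightarrow> nat \<Rightarrow> nat list" where
  "tail_dims d I k \<equiv> map I [Suc k..<Suc d]"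

lemma tail_dims_Cons: "k < d \<Longrightarrow> tail_dims d I k = I (Suc k) # tail_dims d I (Suc k)"
  by (subst upt_conv_Cons) (auto simp del: upt_Suc)

lemma prod_tail_dims_Cons:
  "k < d \<Longrightarrow> (\<Prod>j=Suc k..d. I j) = I (Suc k) * (\<Prod>j=Suc (Suc k)..d. I j)" for I :: "nat \<Rightarrow> nat"
  by (simp add: prod.atLeast_Suc_atMost)

lemma lin_index_tail_less:
  assumes "x \<in> multi_indices (tail_dims d I k)"
  shows "lin_index (tail_dims d I k) x < (\<Prod>j=Suc k..d. I j)"
  using lin_index_bij[of "tail_dims d I k"] assms
  unfolding bij_betw_def prod_list_map_upt by blast

text \<open>The remainder after iteration \<open>k\<close>, with the modes in its columns separated again. At
  stage 0 this is the tensor itself: the initial matrix already has the first mode in its rows,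
  whereas at every later stage the rows carry the rank index only.\<close>

definition remainder ::
  "nat \<Rightarrow> (nat \<Rightarrow> nat) \<Rightarrow> (nat \<Rightarrow> nat) \<Rightarrow> tensor \<Rightarrow> (nat \<Rightarrow> ulv) \<Rightarrow> nat \<Rightarrow> nat \<Rightarrow> nat list \<Rightarrow> real"
  where
  "remainder d I r A D k a x =
     (if k = 0 then A x else tt_ulv_C d I r A D k $$ (a, lin_index (tail_dims d I k) x))"

lemma dim_tt_ulv_mat [simp]:
  "dim_row (tt_ulv_mat d I r A D k) = r (k - 1) * I k"
  "dim_col (tt_ulv_mat d I r A D k) = (\<Prod>j=Suc k..d. I j)"
  by (simp_all add: tt_ulv_mat_def mat_of_tensor_def Let_def)

lemma tt_ulv_C_carrier:
  assumes "tt_ulv_run d I r A D" and "0 < k" "k < d"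
  shows "tt_ulv_C d I r A D k \<in> carrier_mat (r k) (\<Prod>j=Suc k..d. I j)"
proof -
  have ulv: "is_ulv (tt_ulv_mat d I r A D k) (r k) (D k)"
    using assms by (auto simp: tt_ulv_run_def)
  obtain k' where "k = Suc k'"
    using assms(2) gr0_implies_Suc by blast
  then show ?thesis
    using ulv_dims(2,3)[OF ulv] by (auto simp: ulv_V1_def leading_cols_def)
qed

lemma mat_reshape_entry:
  assumes "C \<in> carrier_mat m n"
    and "a < m" "b < n" "p < m'" "t < n'" and "a + m * b = p + m' * t"
  shows "mat_of_tensor m' n' (reshape [dim_row C, dim_col C] [m', n'] (tensor_of_mat C)) $$ (p, t)
    = C $$ (a, b)"
proof -
  have "reshape [m, n] [m', n'] (tensor_of_mat C) [p, t] = tensor_of_mat C [a, b]"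
    using assms by (intro reshape_eq) (simp_all add: lin_index_Cons)
  then show ?thesis
    using assms by (simp add: mat_of_tensor_def tensor_of_mat_def)
qed

lemma column_major_less:
  fixes a i m n :: nat
  assumes "a < m" "i < n"
  shows "a + m * i < m * n"
proof -
  have "m * Suc i \<le> m * n"
    using assms by (intro mult_le_mono2) simp
  then show ?thesis using assms by simp
qed

lemma tt_ulv_mat_entry:
  assumes run: "tt_ulv_run d I r A D" and r0: "r 0 = 1" and k: "Suc k < d"
    and a: "a < r k" and i: "i < I (Suc k)" and x: "x \<in> multi_indices (tail_dims d I (Suc k))"
  shows "tt_ulv_mat d I r A D (Suc k) $$ (a + r k * i, lin_index (tail_dims d I (Suc k)) x)
    = remainder d I r A D k a (i # x)"
proof -
  let ?t = "lin_index (tail_dims d I (Suc k)) x" and ?N = "\<Prod>j=Suc (Suc k)..d. I j"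
  have t: "?t < ?N"
    by (rule lin_index_tail_less[OF x])
  have p: "a + r k * i < r k * I (Suc k)"
    by (rule column_major_less[OF a i])
  have lin: "lin_index (tail_dims d I k) (i # x) = i + I (Suc k) * ?t"
    using k by (simp add: tail_dims_Cons lin_index_Cons del: upt_Suc)
  have N: "(\<Prod>j=Suc k..d. I j) = I (Suc k) * ?N"
    using k by (intro prod_tail_dims_Cons) simp
  show ?thesis
  proof (cases "k = 0")
    case True
    let ?C = "tt_ulv_C d I r A D 0"
    have C: "?C \<in> carrier_mat (I 1) ?N"
      using True by (simp add: mat_of_tensor_def numeral_2_eq_2)
    have "tt_ulv_mat d I r A D (Suc k) $$ (a + r k * i, ?t) = ?C $$ (i, ?t)"
      unfolding tt_ulv_mat_def Let_def
      using True a i t p r0 by (simp add: mat_reshape_entry[OF C] del: tt_ulv_C.simps upt_Suc)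
    also have "\<dots> = reshape (dims d I) [I 1, ?N] A [i, ?t]"
      using True i t by (simp add: mat_of_tensor_def numeral_2_eq_2 del: upt_Suc)
    also have "\<dots> = A (i # x)"
    proof (rule reshape_eq)
      have dims: "dims d I = tail_dims d I k"
        using True by (simp add: dims_def)
      show "i # x \<in> multi_indices (dims d I)"
        unfolding dims using k i x by (simp add: tail_dims_Cons del: upt_Suc)
      show "lin_index (dims d I) (i # x) = lin_index [I 1, ?N] [i, ?t]"
        unfolding dims lin using True by (simp add: lin_index_Cons del: upt_Suc)
    qed
    finally show ?thesis
      using True by (simp add: remainder_def)
  next
    case False
    have C: "tt_ulv_C d I r A D k \<in> carrier_mat (r k) (I (Suc k) * ?N)"
      using tt_ulv_C_carrier[OF run, of k] False k N by simp
    have b: "i + I (Suc k) * ?t < I (Suc k) * ?N"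
      by (rule column_major_less[OF i t])
    have "a + r k * (i + I (Suc k) * ?t) = a + r k * i + r k * I (Suc k) * ?t"
      by (simp add: algebra_simps)
    from mat_reshape_entry[OF C a b p t this] show ?thesis
      using False lin by (simp add: tt_ulv_mat_def Let_def remainder_def del: upt_Suc)
  qed
qed

lemma tt_ulv_core_entry:
  assumes "Suc k < d" "a < r k" "i < I (Suc k)" "b < r (Suc k)"
  shows "tt_ulv_core d I r A D (Suc k) [a, i, b]
    = ulv_U1 (r (Suc k)) (D (Suc k)) $$ (a + r k * i, b)"
proof -
  have "reshape [r k * I (Suc k), r (Suc k)] [r k, I (Suc k), r (Suc k)]
      (tensor_of_mat (ulv_U1 (r (Suc k)) (D (Suc k)))) [a, i, b]
    = tensor_of_mat (ulv_U1 (r (Suc k)) (D (Suc k))) [a + r k * i, b]"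
    using assms column_major_less[of a "r k" i "I (Suc k)"]
    by (intro reshape_eq) (simp_all add: lin_index_Cons algebra_simps)
  then show ?thesis
    using assms by (simp add: tt_ulv_core_def tensor_of_mat_def)
qed

lemma tt_ulv_last_core_entry:
  assumes "a < r (d - 1)" "i < I d"
  shows "tt_ulv_core d I r A D d [a, i, 0] = tt_ulv_C d I r A D (d - 1) $$ (a, i)"
proof -
  have "reshape [r (d - 1), I d] [r (d - 1), I d, 1] (tensor_of_mat (tt_ulv_C d I r A D (d - 1))) [a, i, 0]
    = tensor_of_mat (tt_ulv_C d I r A D (d - 1)) [a, i]"
    using assms by (intro reshape_eq) (simp_all add: lin_index_Cons)
  then show ?thesis
    by (simp add: tt_ulv_core_def tensor_of_mat_def)
qed

section \<open>Telescoping the error\<close>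

definition tail_error ::
  "nat \<Rightarrow> (nat \<Rightarrow> nat) \<Rightarrow> (nat \<Rightarrow> nat) \<Rightarrow> tensor \<Rightarrow> (nat \<Rightarrow> ulv) \<Rightarrow> nat \<Rightarrow> real" where
  "tail_error d I r A D k =
     (\<Sum>x\<in>multi_indices (tail_dims d I k). \<Sum>a<r k.
        (remainder d I r A D k a x - tt_tail r (tt_ulv_core d I r A D) (Suc k) x a)\<^sup>2)"

lemma sum_tail_reindex:
  "(\<Sum>x\<in>multi_indices (tail_dims d I k). f (lin_index (tail_dims d I k) x))
    = (\<Sum>t<(\<Prod>j=Suc k..d. I j). f t)"
  using sum.reindex_bij_betw[OF lin_index_bij[of "tail_dims d I k"], of f]
  unfolding prod_list_map_upt .

lemma tail_error_step:
  assumes run: "tt_ulv_run d I r A D" and r0: "r 0 = 1" and k: "Suc k < d"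
  shows "tail_error d I r A D k
    = (tt_ulv_error d I r A D (Suc k))\<^sup>2 + tail_error d I r A D (Suc k)"
proof -
  let ?G = "tt_ulv_core d I r A D" and ?M = "tt_ulv_mat d I r A D (Suc k)"
  let ?J = "tail_dims d I (Suc k)" and ?U = "ulv_U1 (r (Suc k)) (D (Suc k))"
  let ?C = "tt_ulv_C d I r A D (Suc k)" and ?N = "\<Prod>j=Suc (Suc k)..d. I j"
  have ulv: "is_ulv ?M (r (Suc k)) (D (Suc k))"
    using run k by (auto simp: tt_ulv_run_def)
  \<comment> \<open>The contracted trailing cores, with their modes merged into a column index.\<close>
  define X where
    "X b t = tt_tail r ?G (Suc (Suc k)) (inv_into (multi_indices ?J) (lin_index ?J) t) b" for b t
  have X: "X b (lin_index ?J x) = tt_tail r ?G (Suc (Suc k)) x b"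
    if "x \<in> multi_indices ?J" for b x
    using that lin_index_bij[of ?J] by (simp add: X_def bij_betw_def del: upt_Suc)
  have entry: "remainder d I r A D k a (i # x) - tt_tail r ?G (Suc k) (i # x) a
      = ?M $$ (a + r k * i, lin_index ?J x)
        - (\<Sum>b<r (Suc k). ?U $$ (a + r k * i, b) * X b (lin_index ?J x))"
    if "a < r k" "i < I (Suc k)" "x \<in> multi_indices ?J" for a i x
    using that k
    by (simp add: tt_ulv_mat_entry[OF run r0 k] tt_ulv_core_entry X del: upt_Suc)
  have "tail_error d I r A D k = (\<Sum>i<I (Suc k). \<Sum>x\<in>multi_indices ?J. \<Sum>a<r k.
      (remainder d I r A D k a (i # x) - tt_tail r ?G (Suc k) (i # x) a)\<^sup>2)"
    unfolding tail_error_def using k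
    by (simp only: tail_dims_Cons[of k d I] sum_multi_indices_Cons Suc_lessD)
  also have "\<dots> = (\<Sum>i<I (Suc k). \<Sum>x\<in>multi_indices ?J. \<Sum>a<r k.
      (?M $$ (a + r k * i, lin_index ?J x)
        - (\<Sum>b<r (Suc k). ?U $$ (a + r k * i, b) * X b (lin_index ?J x)))\<^sup>2)"
    by (intro sum.cong refl) (simp only: entry lessThan_iff)
  also have "\<dots> = (\<Sum>x\<in>multi_indices ?J. \<Sum>p<r k * I (Suc k).
      (?M $$ (p, lin_index ?J x) - (\<Sum>b<r (Suc k). ?U $$ (p, b) * X b (lin_index ?J x)))\<^sup>2)"
    by (subst sum.swap)
      (simp only: sum_column_major[where f = "\<lambda>p. (?M $$ (p, lin_index ?J _)
        - (\<Sum>b<r (Suc k). ?U $$ (p, b) * X b (lin_index ?J _)))\<^sup>2"])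
  also have "\<dots> = (\<Sum>t<?N. \<Sum>p<r k * I (Suc k).
      (?M $$ (p, t) - (\<Sum>b<r (Suc k). ?U $$ (p, b) * X b t))\<^sup>2)"
    by (rule sum_tail_reindex)
  also have "\<dots> = (tt_ulv_error d I r A D (Suc k))\<^sup>2
      + (\<Sum>t<?N. \<Sum>b<r (Suc k). (?C $$ (b, t) - X b t)\<^sup>2)"
    using ulv_pythagoras[OF ulv, of X] by (simp add: tt_ulv_error_def)
  also have "(\<Sum>t<?N. \<Sum>b<r (Suc k). (?C $$ (b, t) - X b t)\<^sup>2)
      = (\<Sum>x\<in>multi_indices ?J. \<Sum>b<r (Suc k).
          (?C $$ (b, lin_index ?J x) - X b (lin_index ?J x))\<^sup>2)"
    by (rule sum_tail_reindex[symmetric])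
  also have "\<dots> = tail_error d I r A D (Suc k)"
    unfolding tail_error_def
    by (intro sum.cong refl) (simp add: remainder_def X del: upt_Suc tt_ulv_C.simps)
  finally show ?thesis .
qed

lemma tail_error_last:
  assumes "2 \<le> d" and "r d = 1"
  shows "tail_error d I r A D (d - 1) = 0"
proof -
  have J: "tail_dims d I (d - 1) = [I d]"
    using assms by simp
  show ?thesis
    unfolding tail_error_def J sum_multi_indices_Cons
    using assms tt_ulv_last_core_entry[of _ r d _ I A D]
    by (simp add: remainder_def lin_index_Cons J)
qed

lemma tail_error_eq_sum:
  assumes "tt_ulv_run d I r A D" and "r 0 = 1" and "k < d"
  shows "tail_error d I r A D 0
    = (\<Sum>j=1..k. (tt_ulv_error d I r A D j)\<^sup>2) + tail_error d I r A D k"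
  using assms(3) by (induction k) (simp_all add: tail_error_step[OF assms(1,2)])

lemma tensor_norm_eq_tail_error:
  assumes "r 0 = 1"
  shows "tensor_norm (dims d I) (\<lambda>x. A x - tt_ulv_output d I r A D x)
    = sqrt (tail_error d I r A D 0)"
proof -
  have "tt_ulv_output d I r A D x = tt_tail r (tt_ulv_core d I r A D) 1 x 0"
    if "x \<in> multi_indices (tail_dims d I 0)" for x
    using that assms unfolding tt_ulv_output_def
    by (intro tt_tensor_eq_tail) (simp_all add: multi_indices_def del: upt_Suc)
  then show ?thesis
    using assms by (simp add: tensor_norm_def tail_error_def remainder_def dims_def del: upt_Suc)
qed

theorem corollary3p1:
  fixes d :: nat and I r :: "nat \<Rightarrow> nat" and A :: tensor and D :: "nat \<Rightarrow> ulv"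
    and \<epsilon> :: "nat \<Rightarrow> real"
  assumes "d \<ge> 2"
    and "admissible_ranks d I r"
    and "tt_ulv_run d I r A D"
    and "\<And>k. k \<in> {1..d-1} \<Longrightarrow> tt_ulv_error d I r A D k = \<epsilon> k"
  shows "tensor_norm (dims d I) (\<lambda>i. A i - tt_ulv_output d I r A D i)
           \<le> sqrt (\<Sum>k=1..d-1. (\<epsilon> k)\<^sup>2)"
proof -
  have r: "r 0 = 1" "r d = 1"
    using assms(2) by (simp_all add: admissible_ranks_def)
  have "tail_error d I r A D 0 = (\<Sum>k=1..d-1. (tt_ulv_error d I r A D k)\<^sup>2)"
    using tail_error_eq_sum[OF assms(3) r(1), of "d - 1"] tail_error_last[of d r I A D] assms(1) r(2)
    by simp
  also have "\<dots> = (\<Sum>k=1..d-1. (\<epsilon> k)\<^sup>2)"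
    using assms(4) by (intro sum.cong) auto
  finally show ?thesis
    by (simp add: tensor_norm_eq_tail_error[where r = r, OF r(1)])
qed

end
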